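(* Let $\vec{\mathcal C}=\langle C_\alpha:\alpha<\omega_1\rangle$ be a C-sequence, with associated function $\mathrm{Osc}$, and let $X$ and $Y$ be disjoint uncountable subsets of $\omega_1$ such that for all $\delta\in\Lambda'$: whenever $\delta<\alpha<\beta$ and either ($\alpha\in X$ and $\beta\in Y$) or ($\alpha\in Y$ and $\beta\in X$), one has $|\mathrm{Osc}(\alpha,\beta)\cap\delta|>1$. Then the product space $\mathcal L[X]\times\mathcal L[Y]$ does not contain a dense Lindelöf subset.
   Context: C-sequences. A family $\langle C_\alpha:\alpha\in\omega_1\rangle$ is a C-sequence on $\omega_1$ if: $C_0=\{0\}$; for each $0<\alpha<\omega_1$, $0\in C_\alpha$ and $C_\alpha$ is a cofinal subset of $\alpha$ (for $\alpha=\beta+1$ this just means $C_\alpha\subset\alpha$ and $\beta\in C_\alpha$); and for all $\gamma<\alpha$, $C_\alpha\cap\gamma$ is finite. Lower trace. For $\alpha\le\beta<\omega_1$ define recursively $L(\alpha,\alpha)=\emptyset$, and for $0<\alpha<\beta$, $$L(\alpha,\beta)=\bigl(L(\alpha,\min(C_\beta\setminus\alpha))\cup\{\max(C_\beta\cap\alpha)\}\bigr)\setminus\max(C_\beta\cap\alpha),$$ where subtracting the ordinal $m=\max(C_\beta\cap\alpha)$ means deleting all elements $<m$; $L(0,\beta)=\emptyset$. Each $L(\alpha,\beta)$ is a finite subset of $\alpha$. The function $\varrho_1$. For $\alpha\le\beta<\omega_1$: $\varrho_1(\alpha,\alpha)=0$ and, for $\alpha<\beta$, $\varrho_1(\alpha,\beta)=\max\bigl(|C_\beta\cap\alpha|,\varrho_1(\alpha,\min(C_\beta\setminus\alpha))\bigr)$.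 Put $e_\beta(\xi)=\varrho_1(\xi,\beta)$ for $\xi<\beta$. Oscillation. For $\alpha<\beta<\omega_1$, $\mathrm{Osc}(\alpha,\beta)$ is the set of all $\xi\in L(\alpha,\beta)\setminus\{\min L(\alpha,\beta)\}$ such that $e_\alpha(\xi^-)\le e_\beta(\xi^-)$ and $e_\alpha(\xi)>e_\beta(\xi)$, where $\xi^-=\max(L(\alpha,\beta)\cap\xi)$; and $\mathrm{osc}(\alpha,\beta)=|\mathrm{Osc}(\alpha,\beta)|$. Moore's L space. $\mathbb T$ is the unit circle in the complex plane with its usual topology and group structure, and $\mathbb T^{\omega_1}$ has the product topology. Fix a rationally independent set $\{r_\alpha:\alpha<\omega_1\}$ of (distinct) reals in the interval $(0,\frac1{2\pi})$ and let $z_\alpha=e^{2\pi i r_\alpha}$. For $\beta<\omega_1$ define $w_\beta\in\mathbb T^{\omega_1}$ by $w_\beta(\xi)=z_\xi^{\mathrm{osc}(\xi,\beta)+1}$ if $\xi<\beta$ and $w_\beta(\xi)=1$ if $\beta\le\xi$. For $A\subset\omega_1$, $\mathcal L[A]=\{w_\beta:\beta\in A\}$ with the subspace topology from $\mathbb T^{\omega_1}$. $\Lambda$ is the set of (nonzero) limit ordinals in $\omega_1$, and $\Lambda'$ is the set of $\delta\in\Lambda$ such that $\Lambda\cap\delta$ is cofinal in $\delta$. *)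

theory Defs
  imports "HOL-Analysis.Analysis" "HOL-Library.Countable_Set_Type"
begin

section \<open>The ordinal \<open>\<omega>\<^sub>1\<close>\<close>

text \<open>
  A concrete well-ordered type of order type \<open>\<omega>\<^sub>1\<close>, built on the successor cardinal of
  \<open>\<aleph>\<^sub>0\<close>. An ordinal \<open>\<alpha>\<close>, viewed as the set of its predecessors, is \<open>{..<\<alpha>}\<close>.
\<close>

lemma Field_cardSuc_natLeq_nonempty: "Field (cardSuc natLeq) \<noteq> {}"
proof
  assume "Field (cardSuc natLeq) = {}"
  moreover have "infinite (Field (cardSuc natLeq))"
    using cardSuc_finite[OF natLeq_Card_order] by (simp add: Field_natLeq)
  ultimately show False by simp
qed

typedef omega1 = "Field (cardSuc natLeq)"
  using Field_cardSuc_natLeq_nonempty by blast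

lemma cardSuc_natLeq_Card_order: "Card_order (cardSuc natLeq)"
  by (simp add: cardSuc_Card_order natLeq_Card_order)

lemma cardSuc_natLeq_Well_order: "Well_order (cardSuc natLeq)"
  using cardSuc_natLeq_Card_order by (simp add: card_order_on_def)

instantiation omega1 :: wellorder
begin

definition less_eq_omega1 :: "omega1 \<Rightarrow> omega1 \<Rightarrow> bool" where
  "\<alpha> \<le> \<beta> \<longleftrightarrow> (Rep_omega1 \<alpha>, Rep_omega1 \<beta>) \<in> cardSuc natLeq"

definition less_omega1 :: "omega1 \<Rightarrow> omega1 \<Rightarrow> bool" where
  "\<alpha> < \<beta> \<longleftrightarrow> \<alpha> \<le> \<beta> \<and> \<alpha> \<noteq> (\<beta> :: omega1)"

instance
proof
  let ?r = "cardSuc natLeq"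
  have lin: "Linear_order ?r" and wfr: "wf (?r - Id)"
    using cardSuc_natLeq_Well_order by (auto simp: well_order_on_def)
  have rf: "(a, a) \<in> ?r" if "a \<in> Field ?r" for a
    using lin that by (auto simp: linear_order_on_def partial_order_on_def preorder_on_def refl_on_def)
  have tr: "trans ?r" and anti: "antisym ?r" and tot: "total_on (Field ?r) ?r"
    using lin by (auto simp: linear_order_on_def partial_order_on_def preorder_on_def)
  show as: "\<alpha> = \<beta>" if "\<alpha> \<le> \<beta>" "\<beta> \<le> \<alpha>" for \<alpha> \<beta> :: omega1
    using antisymD[OF anti] that unfolding less_eq_omega1_def Rep_omega1_inject[symmetric] by blast
  show le_refl: "\<alpha> \<le> \<alpha>" for \<alpha> :: omega1
    using rf[OF Rep_omega1] by (simp add: less_eq_omega1_def)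
  show "\<alpha> < \<beta> \<longleftrightarrow> \<alpha> \<le> \<beta> \<and> \<not> \<beta> \<le> \<alpha>" for \<alpha> \<beta> :: omega1
    using as le_refl unfolding less_omega1_def by blast
  show "\<alpha> \<le> \<gamma>" if "\<alpha> \<le> \<beta>" "\<beta> \<le> \<gamma>" for \<alpha> \<beta> \<gamma> :: omega1
    using transD[OF tr] that unfolding less_eq_omega1_def by blast
  show "\<alpha> \<le> \<beta> \<or> \<beta> \<le> \<alpha>" for \<alpha> \<beta> :: omega1
    using tot rf Rep_omega1[of \<alpha>] Rep_omega1[of \<beta>]
    unfolding less_eq_omega1_def total_on_def by metis
  fix P :: "omega1 \<Rightarrow> bool" and \<alpha>
  assume ind_step: "\<And>x. (\<And>y. y < x \<Longrightarrow> P y) \<Longrightarrow> P x"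
  have "wf {(x, y :: omega1). x < y}"
    by (rule wf_subset[OF wf_inv_image[OF wfr, of Rep_omega1]])
       (auto simp: inv_image_def less_omega1_def less_eq_omega1_def Rep_omega1_inject)
  then show "P \<alpha>"
  proof (induction \<alpha> rule: wf_induct_rule)
    case (less x)
    then show ?case using ind_step by simp
  qed
qed

end

lemma uncountable_omega1: "uncountable (UNIV :: omega1 set)"
  including cardinal_syntax
proof
  assume "countable (UNIV :: omega1 set)"
  then have "countable (Field (cardSuc natLeq))"
    using countable_image[of UNIV Rep_omega1] type_definition.Rep_range[OF type_definition_omega1]
    by simp
  then have "|Field (cardSuc natLeq)| \<le>o natLeq"
    by (simp add: countable_card_le_natLeq)
  then have "cardSuc natLeq \<le>o natLeq"
    by (rule ordIso_ordLeq_trans[OF ordIso_symmetric[OF card_of_Field_ordIso[OF cardSuc_natLeq_Card_order]]])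
  then show False
    using not_ordLess_ordLeq[OF cardSuc_greater[OF natLeq_Card_order]] by simp
qed

lemma countable_lessThan_omega1: "countable {..<\<alpha> :: omega1}"
  including cardinal_syntax
proof -
  have "|underS (cardSuc natLeq) (Rep_omega1 \<alpha>)| <o cardSuc natLeq"
    by (rule card_of_underS[OF cardSuc_natLeq_Card_order Rep_omega1])
  then have "countable (underS (cardSuc natLeq) (Rep_omega1 \<alpha>))"
    by (simp add: countable_card_le_natLeq natLeq_Card_order card_of_Card_order
        cardSuc_ordLeq_ordLess)
  moreover have "Rep_omega1 ` {..<\<alpha>} \<subseteq> underS (cardSuc natLeq) (Rep_omega1 \<alpha>)"
    by (auto simp: underS_def less_omega1_def less_eq_omega1_def Rep_omega1_inject)
  ultimately have "countable (Rep_omega1 ` {..<\<alpha>})"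
    using countable_subset by blast
  then show ?thesis
    by (rule countable_image_inj_on) (simp add: inj_on_def Rep_omega1_inject)
qed

instantiation omega1 :: zero
begin

definition zero_omega1 :: omega1 where
  "zero_omega1 = (LEAST \<alpha>. True)"

instance ..

end

lemma omega1_zero_le [simp]: "(0 :: omega1) \<le> \<alpha>"
  unfolding zero_omega1_def by (rule Least_le) simp

definition limit_ordinals :: "omega1 set" ("\<Lambda>") where
  "\<Lambda> = {\<delta>. \<delta> \<noteq> 0 \<and> (\<forall>\<gamma><\<delta>. \<exists>\<xi><\<delta>. \<gamma> < \<xi>)}"

definition limits_of_limits :: "omega1 set" ("\<Lambda>''") where
  "\<Lambda>' = {\<delta> \<in> \<Lambda>. \<forall>\<gamma><\<delta>. \<exists>\<xi>\<in>\<Lambda> \<inter> {..<\<delta>}. \<gamma> \<le> \<xi>}"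


section \<open>C-sequences and walks\<close>

definition C_sequence :: "(omega1 \<Rightarrow> omega1 set) \<Rightarrow> bool" where
  "C_sequence C \<longleftrightarrow>
     C 0 = {0} \<and>
     (\<forall>\<alpha>>0. 0 \<in> C \<alpha> \<and> C \<alpha> \<subseteq> {..<\<alpha>} \<and> (\<forall>\<gamma><\<alpha>. \<exists>\<xi>\<in>C \<alpha>. \<gamma> \<le> \<xi>)) \<and>
     (\<forall>\<alpha>. \<forall>\<gamma><\<alpha>. finite (C \<alpha> \<inter> {..<\<gamma>}))"

definition walk_step :: "(omega1 \<Rightarrow> omega1 set) \<Rightarrow> omega1 \<Rightarrow> omega1 \<Rightarrow> omega1" where
  "walk_step C \<alpha> \<beta> = (LEAST \<xi>. \<xi> \<in> C \<beta> - {..<\<alpha>})"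

text \<open>
  The guard \<open>walk_step C \<alpha> \<beta> < \<beta>\<close> in the next two functions only makes them total for arbitrary
  \<open>C\<close>; it holds for every C-sequence whenever \<open>\<alpha> < \<beta>\<close>, see \<open>walk_step_less\<close>. The recursion
  equations without the guard are \<open>lower_trace_rec\<close> and \<open>rho1_rec\<close>.
\<close>

function lower_trace :: "(omega1 \<Rightarrow> omega1 set) \<Rightarrow> omega1 \<Rightarrow> omega1 \<Rightarrow> omega1 set" where
  "lower_trace C \<alpha> \<beta> =
     (if 0 < \<alpha> \<and> \<alpha> < \<beta> \<and> walk_step C \<alpha> \<beta> < \<beta>
      then (lower_trace C \<alpha> (walk_step C \<alpha> \<beta>) \<union> {Max (C \<beta> \<inter> {..<\<alpha>})}) - {..<Max (C \<beta> \<inter> {..<\<alpha>})}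
      else {})"
  by pat_completeness auto
termination
  by (relation "inv_image {(x, y). x < y} (\<lambda>(C, \<alpha>, \<beta>). \<beta>)") (auto simp: wf)

function rho1 :: "(omega1 \<Rightarrow> omega1 set) \<Rightarrow> omega1 \<Rightarrow> omega1 \<Rightarrow> nat" where
  "rho1 C \<alpha> \<beta> =
     (if \<alpha> < \<beta> \<and> walk_step C \<alpha> \<beta> < \<beta>
      then max (card (C \<beta> \<inter> {..<\<alpha>})) (rho1 C \<alpha> (walk_step C \<alpha> \<beta>))
      else 0)"
  by pat_completeness auto
termination
  by (relation "inv_image {(x, y). x < y} (\<lambda>(C, \<alpha>, \<beta>). \<beta>)") (auto simp: wf)

declare lower_trace.simps [simp del] rho1.simps [simp del]

lemma walk_step_mem:
  assumes "C_sequence C" "\<alpha> < \<beta>"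
  shows "walk_step C \<alpha> \<beta> \<in> C \<beta> - {..<\<alpha>}"
proof -
  have "0 < \<beta>" using assms(2) omega1_zero_le[of \<alpha>] by (rule le_less_trans[rotated])
  with assms have "\<exists>\<xi>\<in>C \<beta>. \<alpha> \<le> \<xi>"
    by (simp add: C_sequence_def)
  then obtain \<xi> where "\<xi> \<in> C \<beta>" "\<alpha> \<le> \<xi>" ..
  then show ?thesis
    unfolding walk_step_def by (intro LeastI[of "\<lambda>\<xi>. \<xi> \<in> C \<beta> - {..<\<alpha>}" \<xi>]) simp
qed

lemma walk_step_less:
  assumes "C_sequence C" "\<alpha> < \<beta>"
  shows "walk_step C \<alpha> \<beta> < \<beta>"
proof -
  have "0 < \<beta>" using assms(2) omega1_zero_le[of \<alpha>] by (rule le_less_trans[rotated])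
  with assms(1) have "C \<beta> \<subseteq> {..<\<beta>}"
    by (simp add: C_sequence_def)
  then show ?thesis
    using walk_step_mem[OF assms] by auto
qed

lemma lower_trace_same: "lower_trace C \<alpha> \<alpha> = {}"
  by (subst lower_trace.simps) simp

lemma lower_trace_zero: "lower_trace C 0 \<beta> = {}"
  by (subst lower_trace.simps) simp

lemma lower_trace_rec:
  assumes "C_sequence C" "0 < \<alpha>" "\<alpha> < \<beta>"
  shows "lower_trace C \<alpha> \<beta> =
    (lower_trace C \<alpha> (walk_step C \<alpha> \<beta>) \<union> {Max (C \<beta> \<inter> {..<\<alpha>})}) - {..<Max (C \<beta> \<inter> {..<\<alpha>})}"
  using assms walk_step_less[OF assms(1,3)] by (subst lower_trace.simps) simp

lemma rho1_same: "rho1 C \<alpha> \<alpha> = 0"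
  by (subst rho1.simps) simp

lemma rho1_rec:
  assumes "C_sequence C" "\<alpha> < \<beta>"
  shows "rho1 C \<alpha> \<beta> = max (card (C \<beta> \<inter> {..<\<alpha>})) (rho1 C \<alpha> (walk_step C \<alpha> \<beta>))"
  using assms walk_step_less[OF assms] by (subst rho1.simps) simp

lemma finite_lower_trace: "finite (lower_trace C \<alpha> \<beta>)"
proof (induction C \<alpha> \<beta> rule: lower_trace.induct)
  case (1 C \<alpha> \<beta>)
  then show ?case by (subst lower_trace.simps) simp
qed

lemma lower_trace_subset:
  assumes "C_sequence C"
  shows "lower_trace C \<alpha> \<beta> \<subseteq> {..<\<alpha>}"
  using assms
proof (induction C \<alpha> \<beta> rule: lower_trace.induct)
  case (1 C \<alpha> \<beta>)
  show ?case
  proof (cases "0 < \<alpha> \<and> \<alpha> < \<beta> \<and> walk_step C \<alpha> \<beta> < \<beta>")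
    case True
    then have "0 < \<beta>" using less_trans by blast
    with True 1(2) have "0 \<in> C \<beta> \<inter> {..<\<alpha>}" "finite (C \<beta> \<inter> {..<\<alpha>})"
      by (auto simp: C_sequence_def)
    then have "Max (C \<beta> \<inter> {..<\<alpha>}) \<in> C \<beta> \<inter> {..<\<alpha>}"
      by (intro Max_in) auto
    then show ?thesis
      using 1(1)[OF True 1(2)] by (subst lower_trace.simps) auto
  next
    case False
    then show ?thesis by (subst lower_trace.simps) auto
  qed
qed

definition Osc :: "(omega1 \<Rightarrow> omega1 set) \<Rightarrow> omega1 \<Rightarrow> omega1 \<Rightarrow> omega1 set" where
  "Osc C \<alpha> \<beta> =
     {\<xi> \<in> lower_trace C \<alpha> \<beta> - {Min (lower_trace C \<alpha> \<beta>)}.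
        let \<xi>' = Max (lower_trace C \<alpha> \<beta> \<inter> {..<\<xi>})
        in rho1 C \<xi>' \<alpha> \<le> rho1 C \<xi>' \<beta> \<and> rho1 C \<xi> \<alpha> > rho1 C \<xi> \<beta>}"

lemma finite_Osc: "finite (Osc C \<alpha> \<beta>)"
  by (rule finite_subset[OF _ finite_lower_trace[of C \<alpha> \<beta>]]) (auto simp: Osc_def)

definition osc :: "(omega1 \<Rightarrow> omega1 set) \<Rightarrow> omega1 \<Rightarrow> omega1 \<Rightarrow> nat" where
  "osc C \<alpha> \<beta> = card (Osc C \<alpha> \<beta>)"


section \<open>Moore's L space\<close>

definition rationally_independent :: "real set \<Rightarrow> bool" where
  "rationally_independent R \<longleftrightarrow> \<not> module.dependent (\<lambda>(q :: rat) x. of_rat q * x) R"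

lemma vector_space_rat_real: "vector_space (\<lambda>(q :: rat) (x :: real). of_rat q * x)"
  by unfold_locales (auto simp: algebra_simps of_rat_add of_rat_mult)

definition torus_power :: "(omega1 \<Rightarrow> complex) topology" where
  "torus_power = product_topology (\<lambda>_. top_of_set (sphere 0 1)) UNIV"

definition moore_point ::
  "(omega1 \<Rightarrow> omega1 set) \<Rightarrow> (omega1 \<Rightarrow> real) \<Rightarrow> omega1 \<Rightarrow> omega1 \<Rightarrow> complex" where
  "moore_point C r \<beta> =
     (\<lambda>\<xi>. if \<xi> < \<beta>
          then exp (2 * complex_of_real pi * \<i> * complex_of_real (r \<xi>)) ^ (osc C \<xi> \<beta> + 1)
          else 1)"

definition moore_space ::
  "(omega1 \<Rightarrow> omega1 set) \<Rightarrow> (omega1 \<Rightarrow> real) \<Rightarrow> omega1 set \<Rightarrow> (omega1 \<Rightarrow> complex) topology" where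
  "moore_space C r A = subtopology torus_power (moore_point C r ` A)"

lemma topspace_moore_space: "topspace (moore_space C r A) = moore_point C r ` A"
  by (auto simp: moore_space_def torus_power_def moore_point_def norm_power norm_mult norm_exp_eq_Re)

end

theory Submission
  imports Defs
begin

text \<open>
  Suppose \<open>D\<close> is dense and Lindelof. By density there are \<open>(w_a\<^sub>\<nu>, w_b\<^sub>\<nu>) \<in> D\<close> with
  \<open>\<nu> < a\<^sub>\<nu>, b\<^sub>\<nu>\<close>. For \<open>\<xi>\<close> close to a limit \<open>\<nu>\<close>, the lower trace \<open>L(\<xi>, b)\<close> is
  \<open>L(\<nu>, b)\<close> followed by \<open>L(\<xi>, \<nu>)\<close>, and \<open>e_b = e_\<nu>\<close> on the second part; so \<open>Osc(\<xi>, b)\<close> is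
  \<open>Osc(\<xi>, \<nu>)\<close> plus some points of \<open>L(\<nu>, b)\<close> and possibly \<open>min L(\<xi>, \<nu>)\<close>. Pressing down and a
  pigeonhole argument give an uncountable set \<open>T\<close> of \<open>\<nu>\<close> on which all the finite data agree.
  For \<open>\<mu>, \<nu> \<in> T\<close> and \<open>\<xi> = a\<^sub>\<mu> < \<nu>\<close>, the functions \<open>e_\<xi>\<close> and \<open>e_a\<^sub>\<nu>\<close> agree on
  \<open>L(\<nu>, a\<^sub>\<nu>)\<close>, so \<open>osc(\<xi>, a\<^sub>\<nu>) \<le> osc(\<xi>, \<nu>) + 1\<close>, while the hypothesis on \<open>X\<close> and \<open>Y\<close>
  puts two points of \<open>Osc(\<xi>, b\<^sub>\<nu>)\<close> into \<open>L(\<nu>, b\<^sub>\<nu>)\<close>, so that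
  \<open>osc(\<xi>, \<nu>) + 2 \<le> osc(\<xi>, b\<^sub>\<nu>)\<close>. Hence the \<open>\<xi>\<close>-th coordinates of \<open>w_a\<^sub>\<nu>\<close> and
  \<open>w_b\<^sub>\<nu>\<close> have distance at least some \<open>\<epsilon>\<^sub>\<xi> > 0\<close> independent of \<open>\<nu>\<close>. But the open sets
  \<open>|x(\<xi>) - y(\<xi>)| < \<epsilon>\<^sub>\<xi>\<close> cover the product, since points of the two spaces are eventually \<open>1\<close>,
  and countably many of them miss \<open>(w_a\<^sub>\<nu>, w_b\<^sub>\<nu>)\<close> for all large \<open>\<nu> \<in> T\<close>.
\<close>

section \<open>Countable ordinals\<close>

lemma countable_atMost_omega1: "countable {..\<alpha> :: omega1}"
proof -
  have "{..\<alpha>} = insert \<alpha> {..<\<alpha>}" by auto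
  then show ?thesis using countable_lessThan_omega1[of \<alpha>] by simp
qed

lemma countable_bounded_omega1:
  fixes A :: "omega1 set"
  assumes "countable A"
  shows "\<exists>\<gamma>. \<forall>x\<in>A. x < \<gamma>"
proof (rule ccontr)
  assume "\<nexists>\<gamma>. \<forall>x\<in>A. x < \<gamma>"
  then have "UNIV = (\<Union>x\<in>A. {..x})"
    by (auto simp: not_less)
  moreover have "countable (\<Union>x\<in>A. {..x})"
    using assms countable_atMost_omega1 by blast
  ultimately show False
    using uncountable_omega1 by simp
qed

lemma uncountable_unbounded_omega1:
  fixes A :: "omega1 set"
  assumes "uncountable A"
  obtains x where "x \<in> A" "\<gamma> < x"
proof -
  have "\<not> A \<subseteq> {..\<gamma>}"
    using assms countable_atMost_omega1 countable_subset by blast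
  then show thesis using that by (meson atMost_iff not_le subsetI)
qed

text \<open>A closing-off argument: \<open>h\<close> dominates \<open>g\<close> on initial segments,
  and the supremum of the iterates of \<open>h\<close> from \<gamma> is closed under
  \<open>g\<close>. It yields limits of limits as well as the pressing-down argument.\<close>

lemma closed_limit_ordinal:
  fixes g :: "omega1 \<Rightarrow> omega1"
  obtains \<delta> where "\<delta> \<in> \<Lambda>" "\<gamma> < \<delta>" "\<And>\<eta>. \<eta> < \<delta> \<Longrightarrow> g \<eta> < \<delta>"
proof -
  have "\<exists>y. x < y \<and> (\<forall>\<eta>\<le>x. g \<eta> < y)" for x
  proof -
    have "countable (insert x (g ` {..x}))"
      using countable_atMost_omega1[of x] by simp
    from countable_bounded_omega1[OF this] show ?thesis by auto
  qed
  then obtain h where h: "\<And>x. x < h x" "\<And>x \<eta>. \<eta> \<le> x \<Longrightarrow> g \<eta> < h x"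
    by metis
  define s where "s n = (h ^^ n) \<gamma>" for n
  have s_Suc: "s (Suc n) = h (s n)" for n
    by (simp add: s_def)
  have ex: "\<exists>b. \<forall>n. s n < b"
    using countable_bounded_omega1[of "range s"] by auto
  \<comment> \<open>The iterates increase strictly, so their least strict upper bound is their
    supremum and a limit.\<close>
  define \<delta> where "\<delta> = (LEAST b. \<forall>n. s n < b)"
  have less: "s n < \<delta>" for n
    using LeastI_ex[OF ex] by (simp add: \<delta>_def)
  have below: "\<exists>n. \<eta> \<le> s n" if "\<eta> < \<delta>" for \<eta>
    using not_less_Least[OF that[unfolded \<delta>_def]] by (auto simp: not_less)
  show thesis
  proof
    show "\<gamma> < \<delta>" using less[of 0] by (simp add: s_def)
    then have "\<delta> \<noteq> 0" using omega1_zero_le[of \<gamma>] by (auto simp: not_less[symmetric])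
    moreover have "\<exists>\<xi><\<delta>. \<eta> < \<xi>" if "\<eta> < \<delta>" for \<eta>
      using below[OF that] h(1) less s_Suc by (metis le_less_trans)
    ultimately show "\<delta> \<in> \<Lambda>" by (simp add: limit_ordinals_def)
    show "g \<eta> < \<delta>" if "\<eta> < \<delta>" for \<eta>
      using below[OF that] h(2) less s_Suc by (metis less_trans)
  qed
qed

lemma limits_of_limits_nonempty: "\<exists>\<delta>. \<delta> \<in> \<Lambda>'"
proof -
  have "\<exists>\<delta>. \<delta> \<in> \<Lambda> \<and> \<eta> < \<delta>" for \<eta>
    by (rule closed_limit_ordinal[of \<eta> id]) auto
  then obtain g where g: "\<And>\<eta>. g \<eta> \<in> \<Lambda> \<and> \<eta> < g \<eta>" by metis
  obtain \<delta> where "\<delta> \<in> \<Lambda>" "\<And>\<eta>. \<eta> < \<delta> \<Longrightarrow> g \<eta> < \<delta>"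
    using closed_limit_ordinal[of 0 g] by blast
  then have "\<delta> \<in> \<Lambda>'"
    unfolding limits_of_limits_def using g by (auto intro: less_imp_le)
  then show ?thesis ..
qed

text \<open>A weak form of Fodor's lemma, for functions regressive on a tail of \<Lambda> and with
  uncountable instead of stationary fibres. If \<open>g\<close> bounded every fibre, a limit
  \<delta> closed under \<open>g\<close> would satisfy \<open>f \<delta> < \<delta>\<close> and
  hence \<open>\<delta> < g (f \<delta>) < \<delta>\<close>.\<close>

lemma pressing_down:
  fixes f :: "omega1 \<Rightarrow> omega1"
  assumes "\<And>\<nu>. \<nu> \<in> \<Lambda> \<Longrightarrow> \<gamma> < \<nu> \<Longrightarrow> f \<nu> < \<nu>"
  obtains \<eta> where "uncountable {\<nu> \<in> \<Lambda>. \<gamma> < \<nu> \<and> f \<nu> = \<eta>}"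
proof -
  have "\<exists>\<eta>. uncountable {\<nu> \<in> \<Lambda>. \<gamma> < \<nu> \<and> f \<nu> = \<eta>}"
  proof (rule ccontr)
    assume "\<nexists>\<eta>. uncountable {\<nu> \<in> \<Lambda>. \<gamma> < \<nu> \<and> f \<nu> = \<eta>}"
    then have "\<forall>\<eta>. \<exists>b. \<forall>\<nu>\<in>{\<nu> \<in> \<Lambda>. \<gamma> < \<nu> \<and> f \<nu> = \<eta>}. \<nu> < b"
      using countable_bounded_omega1 by blast
    then obtain g where g: "\<And>\<eta> \<nu>. \<nu> \<in> \<Lambda> \<Longrightarrow> \<gamma> < \<nu> \<Longrightarrow> f \<nu> = \<eta> \<Longrightarrow> \<nu> < g \<eta>"
      by (metis (mono_tags, lifting) mem_Collect_eq)
    obtain \<delta> where "\<delta> \<in> \<Lambda>" "\<gamma> < \<delta>" "\<And>\<eta>. \<eta> < \<delta> \<Longrightarrow> g \<eta> < \<delta>"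
      using closed_limit_ordinal[of \<gamma> g] by blast
    then show False
      using g assms by (metis less_asym)
  qed
  with that show thesis by blast
qed

lemma finite_bounded_below_limit:
  assumes "\<nu> \<in> \<Lambda>" "finite F" "F \<subseteq> {..<\<nu>}"
  obtains \<zeta> where "\<zeta> < \<nu>" "\<And>x. x \<in> F \<Longrightarrow> x < \<zeta>"
proof (cases "F = {}")
  case True
  have "0 < \<nu>" using assms(1) omega1_zero_le[of \<nu>] by (auto simp: limit_ordinals_def order_less_le)
  with True that show thesis by blast
next
  case False
  then have "Max F < \<nu>" using assms by auto
  then obtain \<zeta> where "\<zeta> < \<nu>" "Max F < \<zeta>"
    using assms(1) by (auto simp: limit_ordinals_def)
  with that assms(2) False show thesis by auto
qed


section \<open>Walks below a limit ordinal\<close>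

lemma C_sequenceD:
  assumes "C_sequence C" "\<xi> < \<beta>"
  shows "0 \<in> C \<beta>" "C \<beta> \<subseteq> {..<\<beta>}" "\<exists>c\<in>C \<beta>. \<xi> \<le> c" "finite (C \<beta> \<inter> {..<\<xi>})"
proof -
  have "0 < \<beta>" using le_less_trans[OF omega1_zero_le assms(2)] .
  with assms show "0 \<in> C \<beta>" "C \<beta> \<subseteq> {..<\<beta>}" "\<exists>c\<in>C \<beta>. \<xi> \<le> c" "finite (C \<beta> \<inter> {..<\<xi>})"
    by (auto simp: C_sequence_def)
qed

text \<open>A finite \<open>C \<nu>\<close> would be bounded below the limit \<nu>, against
  cofinality. So it is infinite, and some \<zeta> below \<nu> already lies above \<open>n\<close> of
  its points.\<close>

lemma C_sequence_limit_card:
  assumes C: "C_sequence C" and \<nu>: "\<nu> \<in> \<Lambda>"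
  obtains \<zeta> where "\<zeta> < \<nu>" "\<And>\<xi>. \<zeta> \<le> \<xi> \<Longrightarrow> \<xi> < \<nu> \<Longrightarrow> n \<le> card (C \<nu> \<inter> {..<\<xi>})"
proof -
  have "0 < \<nu>" using \<nu> omega1_zero_le[of \<nu>] by (auto simp: limit_ordinals_def order_less_le)
  note D = C_sequenceD[OF C this]
  have "infinite (C \<nu>)"
  proof
    assume "finite (C \<nu>)"
    then obtain \<zeta> where "\<zeta> < \<nu>" "\<And>x. x \<in> C \<nu> \<Longrightarrow> x < \<zeta>"
      using finite_bounded_below_limit[OF \<nu> _ D(2)] by blast
    then show False using C_sequenceD(3)[OF C, of \<zeta> \<nu>] by (auto simp: not_le[symmetric])
  qed
  then obtain B where B: "finite B" "card B = n" "B \<subseteq> C \<nu>"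
    using infinite_arbitrarily_large by blast
  with D(2) obtain \<zeta> where \<zeta>: "\<zeta> < \<nu>" "\<And>x. x \<in> B \<Longrightarrow> x < \<zeta>"
    using finite_bounded_below_limit[OF \<nu> B(1)] by blast
  show thesis
  proof
    fix \<xi> assume "\<zeta> \<le> \<xi>" "\<xi> < \<nu>"
    then have "B \<subseteq> C \<nu> \<inter> {..<\<xi>}" using B(3) \<zeta>(2) by force
    then show "n \<le> card (C \<nu> \<inter> {..<\<xi>})"
      using C_sequenceD(4)[OF C \<open>\<xi> < \<nu>\<close>] card_mono B(2) by blast
  qed (rule \<zeta>(1))
qed

text \<open>With no point of \<open>C \<beta>\<close> in the interval from \<xi> up to \<nu>, the
  walks from \<beta> to \<xi> and to \<nu> begin alike.\<close>

lemma walk_step_cong: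
  assumes "\<xi> \<le> \<nu>" and "C \<beta> \<inter> {..<\<nu>} \<subseteq> {..<\<xi>}"
  shows "walk_step C \<xi> \<beta> = walk_step C \<nu> \<beta>" "C \<beta> \<inter> {..<\<xi>} = C \<beta> \<inter> {..<\<nu>}"
proof -
  have "C \<beta> - {..<\<xi>} = C \<beta> - {..<\<nu>}" using assms by force
  then show "walk_step C \<xi> \<beta> = walk_step C \<nu> \<beta>" by (simp add: walk_step_def)
  show "C \<beta> \<inter> {..<\<xi>} = C \<beta> \<inter> {..<\<nu>}" using assms by force
qed

text \<open>For \<xi> close to \<nu> the walk from \<beta> to \<xi> passes through \<nu>. The steps
  before \<nu> have fixed finite weights, which are absorbed by
  \<open>card (C \<nu> \<inter> {..<\<xi>})\<close> since this grows without bound as \<xi>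
  approaches \<nu>.\<close>

lemma rho1_eventually_eq:
  assumes C: "C_sequence C" and \<nu>: "\<nu> \<in> \<Lambda>" and "\<nu> \<le> \<beta>"
  shows "\<exists>\<zeta><\<nu>. \<forall>\<xi>. \<zeta> \<le> \<xi> \<and> \<xi> < \<nu> \<longrightarrow> rho1 C \<xi> \<beta> = rho1 C \<xi> \<nu>"
  using \<open>\<nu> \<le> \<beta>\<close>
proof (induction \<beta> rule: less_induct)
  case (less \<beta>)
  show ?case
  proof (cases "\<beta> = \<nu>")
    case True
    have "0 < \<nu>" using \<nu> omega1_zero_le[of \<nu>] by (auto simp: limit_ordinals_def order_less_le)
    with True show ?thesis by blast
  next
    case False
    with less.prems have "\<nu> < \<beta>" by simp
    define n where "n = card (C \<beta> \<inter> {..<\<nu>})"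
    have "walk_step C \<nu> \<beta> < \<beta>" "\<nu> \<le> walk_step C \<nu> \<beta>"
      using walk_step_less[OF C \<open>\<nu> < \<beta>\<close>] walk_step_mem[OF C \<open>\<nu> < \<beta>\<close>] by auto
    from less.IH[OF this] obtain \<zeta>1 where \<zeta>1: "\<zeta>1 < \<nu>"
      "\<And>\<xi>. \<zeta>1 \<le> \<xi> \<Longrightarrow> \<xi> < \<nu> \<Longrightarrow> rho1 C \<xi> (walk_step C \<nu> \<beta>) = rho1 C \<xi> \<nu>"
      by blast
    obtain \<zeta>2 where \<zeta>2: "\<zeta>2 < \<nu>" "\<And>x. x \<in> C \<beta> \<inter> {..<\<nu>} \<Longrightarrow> x < \<zeta>2"
      using finite_bounded_below_limit[OF \<nu> C_sequenceD(4)[OF C \<open>\<nu> < \<beta>\<close>]] by blast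
    obtain \<zeta>3 where \<zeta>3: "\<zeta>3 < \<nu>" "\<And>\<xi>. \<zeta>3 \<le> \<xi> \<Longrightarrow> \<xi> < \<nu> \<Longrightarrow> n \<le> card (C \<nu> \<inter> {..<\<xi>})"
      using C_sequence_limit_card[OF C \<nu>] by blast
    \<comment> \<open>Beyond \<zeta>1 the rest of the walk is settled by induction, beyond \<zeta>2
      its first step is the one towards \<nu>, and beyond \<zeta>3 the weight \<open>n\<close> of
      that step is absorbed.\<close>
    have "rho1 C \<xi> \<beta> = rho1 C \<xi> \<nu>" if "max \<zeta>1 (max \<zeta>2 \<zeta>3) \<le> \<xi>" "\<xi> < \<nu>" for \<xi>
    proof -
      have "C \<beta> \<inter> {..<\<nu>} \<subseteq> {..<\<xi>}" using \<zeta>2(2) that by force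
      note cong = walk_step_cong[of _ _ C, OF less_imp_le[OF \<open>\<xi> < \<nu>\<close>] this]
      have "rho1 C \<xi> \<beta> = max n (rho1 C \<xi> \<nu>)"
        using rho1_rec[OF C less_trans[OF \<open>\<xi> < \<nu>\<close> \<open>\<nu> < \<beta>\<close>]] cong \<zeta>1(2) that by (simp add: n_def)
      moreover have "n \<le> rho1 C \<xi> \<nu>"
        using rho1_rec[OF C \<open>\<xi> < \<nu>\<close>] \<zeta>3(2)[of \<xi>] that by simp
      ultimately show ?thesis by simp
    qed
    moreover have "max \<zeta>1 (max \<zeta>2 \<zeta>3) < \<nu>" using \<zeta>1 \<zeta>2 \<zeta>3 by simp
    ultimately show ?thesis by blast
  qed
qed

text \<open>The first step of the walk from \<nu> deletes everything below
  \<open>Max (C \<nu> \<inter> {..<\<xi>})\<close>. This pushes the trace towards \<nu> as \<xi>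
  increases.\<close>

lemma lower_trace_ge:
  assumes C: "C_sequence C" and "\<xi> < \<nu>" "c \<in> C \<nu>" "c < \<xi>" "x \<in> lower_trace C \<xi> \<nu>"
  shows "c \<le> x"
proof -
  have "0 < \<xi>" using le_less_trans[OF omega1_zero_le \<open>c < \<xi>\<close>] .
  then have "Max (C \<nu> \<inter> {..<\<xi>}) \<le> x"
    using assms(5) lower_trace_rec[OF C _ \<open>\<xi> < \<nu>\<close>] C_sequenceD(4)[OF C \<open>\<xi> < \<nu>\<close>] assms(3,4)
    by (auto simp: not_less)
  moreover have "c \<le> Max (C \<nu> \<inter> {..<\<xi>})"
    using C_sequenceD(4)[OF C \<open>\<xi> < \<nu>\<close>] assms(3,4) by simp
  ultimately show ?thesis by simp
qed

text \<open>The bound \<zeta> separates the two traces. The steps before \<nu> contribute the same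
  maxima for \<xi> as for \<nu>; these lie below \<zeta>, so the truncations at them remove nothing
  from \<open>lower_trace C \<xi> \<nu>\<close>.\<close>

lemma lower_trace_split:
  assumes C: "C_sequence C" and "0 < \<xi>" "\<xi> < \<nu>" "\<nu> \<le> \<beta>" "\<zeta> \<le> \<xi>"
    and "\<And>x. x \<in> lower_trace C \<nu> \<beta> \<Longrightarrow> x < \<zeta>"
    and "\<And>x. x \<in> lower_trace C \<xi> \<nu> \<Longrightarrow> \<zeta> \<le> x"
  shows "lower_trace C \<xi> \<beta> = lower_trace C \<xi> \<nu> \<union> lower_trace C \<nu> \<beta>"
  using assms(4,6)
proof (induction \<beta> rule: less_induct)
  case (less \<beta>)
  show ?case
  proof (cases "\<beta> = \<nu>")
    case True
    then show ?thesis by (simp add: lower_trace_same)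
  next
    case False
    with less.prems have "\<nu> < \<beta>" by simp
    define m where "m = Max (C \<beta> \<inter> {..<\<nu>})"
    have "0 < \<nu>" using \<open>0 < \<xi>\<close> \<open>\<xi> < \<nu>\<close> by simp
    have L\<nu>: "lower_trace C \<nu> \<beta> = (lower_trace C \<nu> (walk_step C \<nu> \<beta>) \<union> {m}) - {..<m}"
      using lower_trace_rec[OF C \<open>0 < \<nu>\<close> \<open>\<nu> < \<beta>\<close>] by (simp add: m_def)
    then have "m < \<zeta>" using less.prems(2) by auto
    have "C \<beta> \<inter> {..<\<nu>} \<subseteq> {..<\<xi>}"
    proof
      fix x assume "x \<in> C \<beta> \<inter> {..<\<nu>}"
      then have "x \<le> m"
        using C_sequenceD(4)[OF C \<open>\<nu> < \<beta>\<close>] by (simp add: m_def)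
      then show "x \<in> {..<\<xi>}" using \<open>m < \<zeta>\<close> \<open>\<zeta> \<le> \<xi>\<close> by simp
    qed
    note cong = walk_step_cong[of _ _ C, OF less_imp_le[OF \<open>\<xi> < \<nu>\<close>] this]
    have "lower_trace C \<xi> (walk_step C \<nu> \<beta>) = lower_trace C \<xi> \<nu> \<union> lower_trace C \<nu> (walk_step C \<nu> \<beta>)"
    proof (rule less.IH)
      show "walk_step C \<nu> \<beta> < \<beta>" "\<nu> \<le> walk_step C \<nu> \<beta>"
        using walk_step_less[OF C \<open>\<nu> < \<beta>\<close>] walk_step_mem[OF C \<open>\<nu> < \<beta>\<close>] by auto
      \<comment> \<open>A point missing from the trace to \<beta> was deleted because it is below
        \<open>m\<close>, hence it is below \<zeta> as well.\<close>
      show "x < \<zeta>" if "x \<in> lower_trace C \<nu> (walk_step C \<nu> \<beta>)" for x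
        using that less.prems(2)[of x] L\<nu> \<open>m < \<zeta>\<close> by (cases "x < m") auto
    qed
    moreover have "lower_trace C \<xi> \<beta> = (lower_trace C \<xi> (walk_step C \<nu> \<beta>) \<union> {m}) - {..<m}"
      using lower_trace_rec[OF C \<open>0 < \<xi>\<close> less_trans[OF \<open>\<xi> < \<nu>\<close> \<open>\<nu> < \<beta>\<close>]] cong by (simp add: m_def)
    ultimately show ?thesis
      using L\<nu> assms(7) \<open>m < \<zeta>\<close> by force
  qed
qed


section \<open>Oscillation below a limit ordinal\<close>

text \<open>Apart from the minimum, a point of \<open>lower_trace C \<xi> \<nu>\<close> keeps its
  predecessor in the longer trace, because the added points lie below \<zeta>; the values compared
  there agree by \<open>e\<close>. The minimum is excluded since it may gain a predecessor in
  \<open>lower_trace C \<nu> \<beta>\<close> and so become an oscillation.\<close>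

lemma Osc_split:
  assumes C: "C_sequence C" and "0 < \<xi>" "\<xi> < \<nu>" "\<nu> \<le> \<beta>" "\<zeta> \<le> \<xi>"
    and F: "\<And>x. x \<in> lower_trace C \<nu> \<beta> \<Longrightarrow> x < \<zeta>"
    and A: "\<And>x. x \<in> lower_trace C \<xi> \<nu> \<Longrightarrow> \<zeta> \<le> x"
    and e: "\<And>x. \<zeta> \<le> x \<Longrightarrow> x < \<nu> \<Longrightarrow> rho1 C x \<beta> = rho1 C x \<nu>"
  shows "Osc C \<xi> \<beta> \<inter> (lower_trace C \<xi> \<nu> - {Min (lower_trace C \<xi> \<nu>)}) = Osc C \<xi> \<nu>"
proof -
  let ?A = "lower_trace C \<xi> \<nu>" and ?F = "lower_trace C \<nu> \<beta>"
  have split: "lower_trace C \<xi> \<beta> = ?A \<union> ?F"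
    by (rule lower_trace_split[OF C assms(2-5) F A])
  have "x \<in> Osc C \<xi> \<beta> \<longleftrightarrow> x \<in> Osc C \<xi> \<nu>" if x: "x \<in> ?A" "x \<noteq> Min ?A" for x
  proof -
    let ?y = "Max (?A \<inter> {..<x})"
    have fin: "finite ?A" "finite ?F" by (simp_all add: finite_lower_trace)
    have "Min ?A \<in> ?A" using fin x(1) by (intro Min_in) auto
    have "Min ?A < x" using fin x Min_le[of ?A x] by (simp add: order_less_le)
    then have y: "?y \<in> ?A \<inter> {..<x}" 
      using fin \<open>Min ?A \<in> ?A\<close> \<open>Min ?A < x\<close> by (intro Max_in) auto
    have pred: "Max ((?A \<union> ?F) \<inter> {..<x}) = ?y"
    proof (rule Max_eqI)
      show "finite ((?A \<union> ?F) \<inter> {..<x})" using fin by simp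
      show "?y \<in> (?A \<union> ?F) \<inter> {..<x}" using y by blast
      fix u assume "u \<in> (?A \<union> ?F) \<inter> {..<x}"
      then consider "u \<in> ?A \<inter> {..<x}" | "u < \<zeta>" using F by blast
      then show "u \<le> ?y"
        using A[of ?y] y fin by cases auto
    qed
    have "Min (?A \<union> ?F) \<le> Min ?A"
      using \<open>Min ?A \<in> ?A\<close> fin by (intro Min_le) auto
    then have "x \<noteq> Min (?A \<union> ?F)" using \<open>Min ?A < x\<close> by (simp add: not_less[symmetric])
    moreover have "x < \<nu>" "?y < \<nu>"
      using x(1) y lower_trace_subset[OF C, of \<xi> \<nu>] \<open>\<xi> < \<nu>\<close> by fastforce+
    ultimately show ?thesis
      using x e[OF A[OF x(1)]] e[OF A[of ?y]] y unfolding Osc_def split Let_def by (simp add: pred)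
  qed
  moreover have "Osc C \<xi> \<nu> \<subseteq> ?A - {Min ?A}" by (auto simp: Osc_def)
  ultimately show ?thesis by blast
qed

text \<open>The parameter \<gamma> serves to locate oscillations: those inherited from \<nu> lie at
  or above it, so any below it come from \<open>lower_trace C \<nu> \<beta>\<close>.\<close>

lemma Osc_eventually:
  assumes C: "C_sequence C" and \<nu>: "\<nu> \<in> \<Lambda>" and "\<nu> \<le> \<beta>" "\<gamma> < \<nu>"
  shows "\<exists>\<eta><\<nu>. \<gamma> \<le> \<eta> \<and> lower_trace C \<nu> \<beta> \<subseteq> {..<\<eta>} \<and> (\<forall>\<xi>. \<eta> < \<xi> \<and> \<xi> < \<nu> \<longrightarrow>
    Osc C \<xi> \<nu> \<subseteq> Osc C \<xi> \<beta> \<inter> {\<gamma>..} \<and>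
    Osc C \<xi> \<beta> \<inter> {..<\<gamma>} \<subseteq> lower_trace C \<nu> \<beta> \<and>
    Osc C \<xi> \<beta> \<subseteq> insert (Min (lower_trace C \<xi> \<nu>)) (Osc C \<xi> \<nu>) \<union> lower_trace C \<nu> \<beta>)"
proof -
  obtain \<zeta>1 where \<zeta>1: "\<zeta>1 < \<nu>" "\<And>\<xi>. \<zeta>1 \<le> \<xi> \<Longrightarrow> \<xi> < \<nu> \<Longrightarrow> rho1 C \<xi> \<beta> = rho1 C \<xi> \<nu>"
    using rho1_eventually_eq[OF C \<nu> \<open>\<nu> \<le> \<beta>\<close>] by blast
  obtain \<zeta>2 where \<zeta>2: "\<zeta>2 < \<nu>" "\<And>x. x \<in> lower_trace C \<nu> \<beta> \<Longrightarrow> x < \<zeta>2"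
    using finite_bounded_below_limit[OF \<nu> finite_lower_trace lower_trace_subset[OF C]] by blast
  define \<zeta> where "\<zeta> = max \<gamma> (max \<zeta>1 \<zeta>2)"
  have "\<zeta> < \<nu>" and ge: "\<gamma> \<le> \<zeta>" "\<zeta>1 \<le> \<zeta>" "\<zeta>2 \<le> \<zeta>"
    using \<zeta>1(1) \<zeta>2(1) \<open>\<gamma> < \<nu>\<close> by (auto simp: \<zeta>_def le_max_iff_disj)
  \<comment> \<open>This point is the threshold \<eta>: once \<xi> passes it,
    \<open>lower_trace_ge\<close> keeps the trace from \<nu> above \<zeta>.\<close>
  obtain c where c: "c \<in> C \<nu>" "\<zeta> \<le> c"
    using C_sequenceD(3)[OF C \<open>\<zeta> < \<nu>\<close>] by blast
  have "c < \<nu>" using c C_sequenceD(2)[OF C \<open>\<zeta> < \<nu>\<close>] by auto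
  have F: "x < \<zeta>" if "x \<in> lower_trace C \<nu> \<beta>" for x
    using \<zeta>2(2)[OF that] ge by simp
  have "Osc C \<xi> \<nu> \<subseteq> Osc C \<xi> \<beta> \<inter> {\<gamma>..} \<and>
    Osc C \<xi> \<beta> \<inter> {..<\<gamma>} \<subseteq> lower_trace C \<nu> \<beta> \<and>
    Osc C \<xi> \<beta> \<subseteq> insert (Min (lower_trace C \<xi> \<nu>)) (Osc C \<xi> \<nu>) \<union> lower_trace C \<nu> \<beta>"
    if "c < \<xi>" "\<xi> < \<nu>" for \<xi>
  proof -
    have A: "\<zeta> \<le> x" if "x \<in> lower_trace C \<xi> \<nu>" for x
      using lower_trace_ge[OF C \<open>\<xi> < \<nu>\<close> c(1) \<open>c < \<xi>\<close> that] c(2) by simp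
    have "0 < \<xi>" using le_less_trans[OF omega1_zero_le \<open>c < \<xi>\<close>] .
    have "\<zeta> \<le> \<xi>" using c(2) that by simp
    have e: "rho1 C x \<beta> = rho1 C x \<nu>" if "\<zeta> \<le> x" "x < \<nu>" for x
      using \<zeta>1(2) that ge by simp
    have "lower_trace C \<xi> \<beta> = lower_trace C \<xi> \<nu> \<union> lower_trace C \<nu> \<beta>"
      by (rule lower_trace_split[OF C \<open>0 < \<xi>\<close> \<open>\<xi> < \<nu>\<close> \<open>\<nu> \<le> \<beta>\<close> \<open>\<zeta> \<le> \<xi>\<close> F A])
    moreover have "Osc C \<xi> \<beta> \<inter> (lower_trace C \<xi> \<nu> - {Min (lower_trace C \<xi> \<nu>)}) = Osc C \<xi> \<nu>"
      by (rule Osc_split[OF C \<open>0 < \<xi>\<close> \<open>\<xi> < \<nu>\<close> \<open>\<nu> \<le> \<beta>\<close> \<open>\<zeta> \<le> \<xi>\<close> F A e])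
    moreover have "Osc C \<xi> \<beta> \<subseteq> lower_trace C \<xi> \<beta>" by (auto simp: Osc_def)
    moreover have "\<gamma> \<le> x" if "x \<in> lower_trace C \<xi> \<nu>" for x
      using A[OF that] ge by simp
    moreover have "Osc C \<xi> \<nu> \<subseteq> lower_trace C \<xi> \<nu>" by (auto simp: Osc_def)
    ultimately show ?thesis by (fastforce simp: not_less[symmetric])
  qed
  moreover have "\<gamma> \<le> c" "lower_trace C \<nu> \<beta> \<subseteq> {..<c}" using F c(2) ge by force+
  ultimately show ?thesis using \<open>c < \<nu>\<close> by blast
qed


section \<open>Coordinates of Moore's points\<close>

lemma root_of_unity_rational:
  assumes "exp (2 * complex_of_real pi * \<i> * complex_of_real t) ^ k = 1" "0 < k"
  shows "t \<in> \<rat>"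
proof -
  have "exp (of_nat k * (2 * complex_of_real pi * \<i> * complex_of_real t)) = 1"
    using assms(1) by (simp add: exp_of_nat_mult)
  then obtain n :: int where "Im (of_nat k * (2 * complex_of_real pi * \<i> * complex_of_real t)) = of_int (2 * n) * pi"
    by (auto simp: exp_eq_1)
  then have "real k * t = of_int n" by simp
  then have "t = of_int n / of_nat k" using assms(2) by (simp add: field_simps)
  then show ?thesis by simp
qed

text \<open>Two distinct nonzero rationals satisfy the nontrivial relation
  \<open>t * s - s * t = 0\<close> with rational coefficients \<open>t\<close> and
  \<open>- s\<close>.\<close>

lemma rationally_independent_rational_unique:
  assumes "rationally_independent R" "s \<in> R" "t \<in> R" "s \<in> \<rat>" "t \<in> \<rat>"
  shows "s = t"
proof (rule ccontr)
  assume "s \<noteq> t"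
  interpret vector_space "\<lambda>(q :: rat) (x :: real). of_rat q * x"
    by (rule vector_space_rat_real)
  obtain p q where pq: "s = of_rat p" "t = of_rat q"
    using assms(4,5) by (auto elim!: Rats_cases)
  have ind: "independent R" using assms(1) by (simp add: rationally_independent_def)
  have nz: "s \<noteq> 0" "t \<noteq> 0" using dependent_zero ind assms(2,3) by auto
  define u where "u v = (if v = s then q else - p)" for v
  have "(\<Sum>v\<in>{s, t}. of_rat (u v) * v) = 0"
    using \<open>s \<noteq> t\<close> by (simp add: u_def pq of_rat_minus)
  moreover have "u s \<noteq> 0" using nz pq by (auto simp: u_def)
  ultimately have "dependent R"
    unfolding dependent_explicit using assms(2,3) by (intro exI[of _ "{s, t}"]) auto
  with ind show False by simp
qed

lemma dist_unit_powers:
  fixes z :: complex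
  assumes "norm z = 1" "a \<le> b"
  shows "dist (z ^ a) (z ^ b) = dist 1 (z ^ (b - a))"
proof -
  have "z ^ a - z ^ b = z ^ a * (1 - z ^ (b - a))"
    using assms(2) by (simp add: algebra_simps flip: power_add)
  then show ?thesis using assms(1) by (simp add: dist_norm norm_mult norm_power)
qed

text \<open>Multiplication by \<open>z ^ a\<close> is an isometry, so only the finitely many
  differences \<open>b - a\<close> up to \<open>N\<close> matter.\<close>

lemma power_separation:
  fixes z :: complex
  assumes "norm z = 1" "\<And>k. 0 < k \<Longrightarrow> z ^ k \<noteq> 1"
  obtains \<epsilon> where "0 < \<epsilon>" "\<And>a b. a < b \<Longrightarrow> b \<le> a + N \<Longrightarrow> \<epsilon> \<le> dist (z ^ a) (z ^ b)"
proof
  \<comment> \<open>The extra element 1 keeps the set nonempty when \<open>N = 0\<close>.\<close>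
  let ?E = "insert 1 ((\<lambda>k. dist 1 (z ^ k)) ` {1..N})"
  show "0 < Min ?E" using assms(2) by (auto simp: zero_less_dist_iff)
  fix a b :: nat assume "a < b" "b \<le> a + N"
  then have "b - a \<in> {1..N}" by auto
  then have "dist 1 (z ^ (b - a)) \<in> ?E" by blast
  then have "Min ?E \<le> dist 1 (z ^ (b - a))" by (intro Min_le) auto
  then show "Min ?E \<le> dist (z ^ a) (z ^ b)"
    using dist_unit_powers[OF assms(1)] \<open>a < b\<close> by simp
qed

lemma continuous_map_moore_coordinate:
  "continuous_map (moore_space C r A) euclidean (\<lambda>x. x \<xi>)"
proof -
  have "continuous_map torus_power (top_of_set (sphere 0 1)) (\<lambda>x. x \<xi>)"
    unfolding torus_power_def by (rule continuous_map_product_projection) simp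
  then show ?thesis
    unfolding moore_space_def by (intro continuous_map_from_subtopology) (rule continuous_map_into_fulltopology)
qed

lemma openin_moore_product_coordinate:
  assumes "open W"
  shows "openin (prod_topology (moore_space C r A) (moore_space C r B))
    {p \<in> topspace (prod_topology (moore_space C r A) (moore_space C r B)). (fst p \<xi>, snd p \<xi>) \<in> W}"
proof (rule openin_continuous_map_preimage)
  let ?P = "prod_topology (moore_space C r A) (moore_space C r B)"
  have "continuous_map ?P (prod_topology euclidean euclidean) (\<lambda>p. (fst p \<xi>, snd p \<xi>))"
    using continuous_map_compose[OF continuous_map_fst continuous_map_moore_coordinate]
      continuous_map_compose[OF continuous_map_snd continuous_map_moore_coordinate]
    unfolding o_def by (intro continuous_map_pairedI) blast+
  then show "continuous_map ?P euclidean (\<lambda>p. (fst p \<xi>, snd p \<xi>))"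
    by (simp add: prod_topology_euclidean)
  show "openin euclidean W" using assms by simp
qed


section \<open>Products of Moore spaces\<close>

theorem theorem5p7:
  fixes C :: "omega1 \<Rightarrow> omega1 set"
    and r :: "omega1 \<Rightarrow> real"
    and X Y :: "omega1 set"
  assumes "C_sequence C"
    and "inj r"
    and "range r \<subseteq> {0<..<1 / (2 * pi)}"
    and "rationally_independent (range r)"
    and "uncountable X"
    and "uncountable Y"
    and "X \<inter> Y = {}"
    and "\<And>\<delta> \<alpha> \<beta>. \<lbrakk>\<delta> \<in> \<Lambda>'; \<delta> < \<alpha>; \<alpha> < \<beta>; (\<alpha> \<in> X \<and> \<beta> \<in> Y) \<or> (\<alpha> \<in> Y \<and> \<beta> \<in> X)\<rbrakk>
           \<Longrightarrow> card (Osc C \<alpha> \<beta> \<inter> {..<\<delta>}) > 1"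
  shows "\<not> (\<exists>D \<subseteq> topspace (prod_topology (moore_space C r X) (moore_space C r Y)).
              prod_topology (moore_space C r X) (moore_space C r Y) closure_of D
                = topspace (prod_topology (moore_space C r X) (moore_space C r Y)) \<and>
              Lindelof_space (subtopology (prod_topology (moore_space C r X) (moore_space C r Y)) D))"
proof
  let ?P = "prod_topology (moore_space C r X) (moore_space C r Y)"
  let ?w = "moore_point C r"
  assume "\<exists>D\<subseteq>topspace ?P. ?P closure_of D = topspace ?P \<and> Lindelof_space (subtopology ?P D)"
  then obtain D where D: "D \<subseteq> topspace ?P" and dense: "?P closure_of D = topspace ?P"
    and Lindelof: "Lindelof_space (subtopology ?P D)" by blast
  have D_cases: "\<exists>\<alpha>\<in>X. \<exists>\<beta>\<in>Y. p = (?w \<alpha>, ?w \<beta>)" if "p \<in> D" for p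
    using subsetD[OF D that] by (auto simp: topspace_moore_space)
  define z where "z \<xi> = exp (2 * complex_of_real pi * \<i> * complex_of_real (r \<xi>))" for \<xi>
  have norm_z: "norm (z \<xi>) = 1" for \<xi> by (simp add: z_def norm_exp_eq_Re)
  have w: "?w \<beta> \<xi> = (if \<xi> < \<beta> then z \<xi> ^ (osc C \<xi> \<beta> + 1) else 1)" for \<beta> \<xi>
    by (simp add: moore_point_def z_def)
  \<comment> \<open>A rationally independent set may contain one rational number, so one \<open>z \<xi>\<close> may be a root of unity.\<close>
  have "\<exists>\<xi>0. \<forall>\<xi>>\<xi>0. r \<xi> \<notin> \<rat>"
  proof (cases "\<exists>\<xi>0. r \<xi>0 \<in> \<rat>")
    case True
    then obtain \<xi>0 where "r \<xi>0 \<in> \<rat>" ..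
    then have "r \<xi> \<notin> \<rat>" if "\<xi>0 < \<xi>" for \<xi>
      using rationally_independent_rational_unique[OF \<open>rationally_independent (range r)\<close>] that \<open>inj r\<close>
      by (metis injD less_irrefl rangeI)
    then show ?thesis by blast
  qed blast
  then obtain \<xi>0 where \<xi>0: "\<And>\<xi> k. \<xi>0 < \<xi> \<Longrightarrow> 0 < k \<Longrightarrow> z \<xi> ^ k \<noteq> 1"
    unfolding z_def using root_of_unity_rational by blast

  \<comment> \<open>Pairs in \<open>D\<close> with large indices\<close>
  have "\<exists>\<alpha>\<in>X. \<exists>\<beta>\<in>Y. \<nu> < \<alpha> \<and> \<nu> < \<beta> \<and> (?w \<alpha>, ?w \<beta>) \<in> D" for \<nu>
  proof -
    obtain \<mu> where \<mu>: "max \<nu> \<xi>0 < \<mu>"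
      using uncountable_unbounded_omega1[OF \<open>uncountable X\<close>] by blast
    obtain \<alpha> where \<alpha>: "\<alpha> \<in> X" "\<mu> < \<alpha>"
      using uncountable_unbounded_omega1[OF \<open>uncountable X\<close>] .
    obtain \<beta> where \<beta>: "\<beta> \<in> Y" "\<mu> < \<beta>"
      using uncountable_unbounded_omega1[OF \<open>uncountable Y\<close>] .
    \<comment> \<open>A coordinate different from 1 at \<mu> forces an index above \<mu>. Conversely
      \<open>V\<close> is nonempty, because \<open>\<xi>0 < \<mu>\<close> means that
      \<open>z \<mu>\<close> is not a root of unity.\<close>
    define V where "V = {p \<in> topspace ?P. (fst p \<mu>, snd p \<mu>) \<in> (- {1}) \<times> (- {1})}"
    have "openin ?P V"
      unfolding V_def by (rule openin_moore_product_coordinate) (auto intro: open_Times)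
    moreover have "(?w \<alpha>, ?w \<beta>) \<in> V"
      using \<alpha> \<beta> \<xi>0[of \<mu> "Suc n" for n] \<mu> by (simp add: V_def topspace_moore_space w)
    moreover have "(?w \<alpha>, ?w \<beta>) \<in> ?P closure_of D"
      using \<alpha> \<beta> dense by (simp add: topspace_moore_space)
    ultimately obtain p where p: "p \<in> D" "p \<in> V"
      by (meson in_closure_of)
    then obtain \<alpha>' \<beta>' where "\<alpha>' \<in> X" "\<beta>' \<in> Y" "p = (?w \<alpha>', ?w \<beta>')"
      using D_cases by blast
    moreover from this have "\<mu> < \<alpha>'" "\<mu> < \<beta>'"
      using p(2) by (auto simp: V_def w split: if_splits)
    ultimately show ?thesis using p(1) \<mu> by (metis less_trans max_less_iff_conj)
  qed
  then obtain a b where ab: "\<And>\<nu>. a \<nu> \<in> X" "\<And>\<nu>. b \<nu> \<in> Y" "\<And>\<nu>. \<nu> < a \<nu>" "\<And>\<nu>. \<nu> < b \<nu>"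
      "\<And>\<nu>. (?w (a \<nu>), ?w (b \<nu>)) \<in> D"
    by metis

  \<comment> \<open>Uniformization by pressing down and pigeonhole\<close>
  obtain \<delta> where \<delta>: "\<delta> \<in> \<Lambda>'" using limits_of_limits_nonempty by blast
  \<comment> \<open>This is the conclusion of \<open>Osc_eventually\<close> at \<delta>. It persists
    when \<eta> grows, so one threshold serves both \<open>a \<nu>\<close> and
    \<open>b \<nu>\<close>.\<close>
  define good where "good \<nu> \<beta> \<eta> \<longleftrightarrow> lower_trace C \<nu> \<beta> \<subseteq> {..<\<eta>} \<and> (\<forall>\<xi>. \<eta> < \<xi> \<and> \<xi> < \<nu> \<longrightarrow>
    Osc C \<xi> \<nu> \<subseteq> Osc C \<xi> \<beta> \<inter> {\<delta>..} \<and>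
    Osc C \<xi> \<beta> \<inter> {..<\<delta>} \<subseteq> lower_trace C \<nu> \<beta> \<and>
    Osc C \<xi> \<beta> \<subseteq> insert (Min (lower_trace C \<xi> \<nu>)) (Osc C \<xi> \<nu>) \<union> lower_trace C \<nu> \<beta>)" for \<nu> \<beta> \<eta>
  have "\<exists>\<eta><\<nu>. \<delta> \<le> \<eta> \<and> good \<nu> (a \<nu>) \<eta> \<and> good \<nu> (b \<nu>) \<eta>" if "\<nu> \<in> \<Lambda>" "\<delta> < \<nu>" for \<nu>
  proof -
    obtain \<eta>1 where \<eta>1: "\<eta>1 < \<nu>" "\<delta> \<le> \<eta>1" "good \<nu> (a \<nu>) \<eta>1"
      using Osc_eventually[OF \<open>C_sequence C\<close> \<open>\<nu> \<in> \<Lambda>\<close> less_imp_le[OF ab(3)] \<open>\<delta> < \<nu>\<close>]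
      unfolding good_def by blast
    obtain \<eta>2 where \<eta>2: "\<eta>2 < \<nu>" "\<delta> \<le> \<eta>2" "good \<nu> (b \<nu>) \<eta>2"
      using Osc_eventually[OF \<open>C_sequence C\<close> \<open>\<nu> \<in> \<Lambda>\<close> less_imp_le[OF ab(4)] \<open>\<delta> < \<nu>\<close>]
      unfolding good_def by blast
    have mono: "good \<nu> \<beta> m" if "good \<nu> \<beta> \<eta>" "\<eta> \<le> m" for \<beta> \<eta> m
    proof -
      have "{..<\<eta>} \<subseteq> {..<m}" and "\<And>\<xi>. m < \<xi> \<Longrightarrow> \<eta> < \<xi>" using that(2) by auto
      with that(1) show ?thesis unfolding good_def by (meson subset_trans)
    qed
    have "good \<nu> (a \<nu>) (max \<eta>1 \<eta>2)" "good \<nu> (b \<nu>) (max \<eta>1 \<eta>2)"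
      using mono[OF \<eta>1(3)] mono[OF \<eta>2(3)] by simp_all
    moreover have "max \<eta>1 \<eta>2 < \<nu>" "\<delta> \<le> max \<eta>1 \<eta>2" using \<eta>1(1,2) \<eta>2(1) by (simp_all add: le_max_iff_disj)
    ultimately show ?thesis by blast
  qed
  then obtain f where f: "\<And>\<nu>. \<nu> \<in> \<Lambda> \<Longrightarrow> \<delta> < \<nu> \<Longrightarrow>
      f \<nu> < \<nu> \<and> \<delta> \<le> f \<nu> \<and> good \<nu> (a \<nu>) (f \<nu>) \<and> good \<nu> (b \<nu>) (f \<nu>)"
    by metis
  obtain \<eta> where unc: "uncountable {\<nu> \<in> \<Lambda>. \<delta> < \<nu> \<and> f \<nu> = \<eta>}"
    using pressing_down[of \<delta> f] f by blast
  define S where "S = {\<nu> \<in> \<Lambda>. \<delta> < \<nu> \<and> f \<nu> = \<eta>}"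
  \<comment> \<open>The first component is the graph of \<open>rho1\<close> towards
    \<open>a \<nu>\<close> on a finite subset of \<eta>, so countably many keys occur. For
    \<open>b \<nu>\<close> only the size of the trace is recorded, to bound oscillation
    numbers.\<close>
  define key where "key \<nu> =
    ((\<lambda>x. (x, rho1 C x (a \<nu>))) ` lower_trace C \<nu> (a \<nu>), card (lower_trace C \<nu> (b \<nu>)))" for \<nu>
  have S: "\<eta> < \<nu>" "\<delta> \<le> \<eta>" "good \<nu> (a \<nu>) \<eta>" "good \<nu> (b \<nu>) \<eta>" if "\<nu> \<in> S" for \<nu>
    using f[of \<nu>] that by (simp_all add: S_def)
  have "key ` S \<subseteq> {G. finite G \<and> G \<subseteq> {..<\<eta>} \<times> UNIV} \<times> UNIV"
    using S(3) unfolding good_def key_def by (auto simp: finite_lower_trace)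
  moreover have "countable ({G. finite G \<and> G \<subseteq> {..<\<eta>} \<times> (UNIV :: nat set)} \<times> (UNIV :: nat set))"
    by (intro countable_SIGMA countable_Collect_finite_subset) (auto simp: countable_lessThan_omega1)
  ultimately have "countable (key ` S)" by (rule countable_subset)
  have "\<exists>k. uncountable {\<nu> \<in> S. key \<nu> = k}"
  proof (rule ccontr)
    assume "\<nexists>k. uncountable {\<nu> \<in> S. key \<nu> = k}"
    then have "countable (\<Union>k\<in>key ` S. {\<nu> \<in> S. key \<nu> = k})"
      using \<open>countable (key ` S)\<close> by blast
    moreover have "(\<Union>k\<in>key ` S. {\<nu> \<in> S. key \<nu> = k}) = S" by blast
    ultimately show False using unc by (simp add: S_def)
  qed
  then obtain G n where unc_T: "uncountable {\<nu> \<in> S. key \<nu> = (G, n)}" by auto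
  define T where "T = {\<nu> \<in> S. key \<nu> = (G, n)}"

  \<comment> \<open>Comparison of oscillation numbers\<close>
  have osc_T: "osc C (a \<mu>) (a \<nu>) < osc C (a \<mu>) (b \<nu>) \<and>
      osc C (a \<mu>) (b \<nu>) \<le> osc C (a \<mu>) (a \<nu>) + (n + 1)" if "\<mu> \<in> T" "\<nu> \<in> T" "a \<mu> < \<nu>" for \<mu> \<nu>
  proof -
    let ?\<xi> = "a \<mu>" and ?F = "lower_trace C \<nu> (a \<nu>)"
    have "\<mu> \<in> S" "\<nu> \<in> S" using that by (auto simp: T_def)
    have "\<eta> < ?\<xi>" using S(1)[OF \<open>\<mu> \<in> S\<close>] ab(3)[of \<mu>] by simp
    have "\<delta> < ?\<xi>" using S(2)[OF \<open>\<mu> \<in> S\<close>] \<open>\<eta> < ?\<xi>\<close> by simp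
    have A: "Osc C ?\<xi> \<nu> \<subseteq> Osc C ?\<xi> (a \<nu>)"
        "Osc C ?\<xi> (a \<nu>) \<subseteq> insert (Min (lower_trace C ?\<xi> \<nu>)) (Osc C ?\<xi> \<nu>) \<union> ?F"
      using S(3)[OF \<open>\<nu> \<in> S\<close>, unfolded good_def] \<open>\<eta> < ?\<xi>\<close> \<open>a \<mu> < \<nu>\<close> by blast+
    have B: "Osc C ?\<xi> \<nu> \<subseteq> Osc C ?\<xi> (b \<nu>) \<inter> {\<delta>..}"
        "Osc C ?\<xi> (b \<nu>) \<subseteq> insert (Min (lower_trace C ?\<xi> \<nu>)) (Osc C ?\<xi> \<nu>) \<union> lower_trace C \<nu> (b \<nu>)"
      using S(4)[OF \<open>\<nu> \<in> S\<close>, unfolded good_def] \<open>\<eta> < ?\<xi>\<close> \<open>a \<mu> < \<nu>\<close> by blast+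
    \<comment> \<open>\<open>a \<mu>\<close> and \<open>a \<nu>\<close> have the same values on \<open>?F\<close>, so no oscillation between them occurs there.\<close>
    have "Osc C ?\<xi> (a \<nu>) \<inter> ?F = {}"
    proof -
      have "rho1 C x ?\<xi> = rho1 C x (a \<nu>)" if "x \<in> ?F" for x
      proof -
        have "(x, rho1 C x (a \<nu>)) \<in> fst (key \<nu>)" using that by (auto simp: key_def)
        also have "fst (key \<nu>) = fst (key \<mu>)" using \<open>\<mu> \<in> T\<close> \<open>\<nu> \<in> T\<close> by (simp add: T_def)
        finally show ?thesis by (auto simp: key_def)
      qed
      then show ?thesis by (auto simp: Osc_def)
    qed
    with A(2) have "Osc C ?\<xi> (a \<nu>) \<subseteq> insert (Min (lower_trace C ?\<xi> \<nu>)) (Osc C ?\<xi> \<nu>)" by blast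
    then have "osc C ?\<xi> (a \<nu>) \<le> card (insert (Min (lower_trace C ?\<xi> \<nu>)) (Osc C ?\<xi> \<nu>))"
      unfolding osc_def by (intro card_mono) (auto simp: finite_Osc)
    then have a_le: "osc C ?\<xi> (a \<nu>) \<le> Suc (osc C ?\<xi> \<nu>)"
      by (auto simp: osc_def card_insert_if finite_Osc split: if_splits)
    have a_ge: "osc C ?\<xi> \<nu> \<le> osc C ?\<xi> (a \<nu>)"
      unfolding osc_def by (rule card_mono[OF finite_Osc A(1)])
    have "?\<xi> < b \<nu>" using \<open>a \<mu> < \<nu>\<close> ab(4)[of \<nu>] by simp
    then have "1 < card (Osc C ?\<xi> (b \<nu>) \<inter> {..<\<delta>})"
      using assms(8)[OF \<delta> \<open>\<delta> < ?\<xi>\<close>] ab by blast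
    \<comment> \<open>\<open>Osc C ?\<xi> \<nu>\<close> lies at or above \<delta>, so the
      oscillations below \<delta> count in addition. There are at least two, which beats the single
      point that \<open>a \<nu>\<close> may gain.\<close>
    moreover have "card (Osc C ?\<xi> (b \<nu>) \<inter> {..<\<delta>}) + osc C ?\<xi> \<nu> \<le> osc C ?\<xi> (b \<nu>)"
    proof -
      have "card (Osc C ?\<xi> (b \<nu>) \<inter> {..<\<delta>}) + card (Osc C ?\<xi> \<nu>) =
          card (Osc C ?\<xi> (b \<nu>) \<inter> {..<\<delta>} \<union> Osc C ?\<xi> \<nu>)"
        using B(1) by (intro card_Un_disjoint[symmetric]) (auto simp: finite_Osc)
      also have "\<dots> \<le> card (Osc C ?\<xi> (b \<nu>))"
        using B(1) by (intro card_mono finite_Osc) auto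
      finally show ?thesis by (simp add: osc_def)
    qed
    \<comment> \<open>The 1 accounts for the minimum of the trace. As the bound is uniform in \<nu>,
      the separation \<epsilon> can depend on the coordinate alone.\<close>
    moreover have "osc C ?\<xi> (b \<nu>) \<le> osc C ?\<xi> \<nu> + (n + 1)"
    proof -
      have "osc C ?\<xi> (b \<nu>) \<le>
          card (insert (Min (lower_trace C ?\<xi> \<nu>)) (Osc C ?\<xi> \<nu>) \<union> lower_trace C \<nu> (b \<nu>))"
        unfolding osc_def using B(2) by (intro card_mono) (auto simp: finite_Osc finite_lower_trace)
      also have "\<dots> \<le> card (insert (Min (lower_trace C ?\<xi> \<nu>)) (Osc C ?\<xi> \<nu>)) + n"
        using card_Un_le[of "insert (Min (lower_trace C ?\<xi> \<nu>)) (Osc C ?\<xi> \<nu>)" "lower_trace C \<nu> (b \<nu>)"]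
          \<open>\<nu> \<in> T\<close> by (simp add: T_def key_def)
      also have "\<dots> \<le> osc C ?\<xi> \<nu> + (n + 1)"
        by (simp add: osc_def card_insert_if finite_Osc)
      finally show ?thesis .
    qed
    ultimately show ?thesis using a_le a_ge by linarith
  qed

  \<comment> \<open>An open cover of \<open>D\<close> without a countable subcover\<close>
  have "\<exists>\<epsilon>>0. \<forall>i j. i < j \<longrightarrow> j \<le> i + (n + 1) \<longrightarrow> \<epsilon> \<le> dist (z \<xi> ^ i) (z \<xi> ^ j)" if "\<xi>0 < \<xi>" for \<xi>
    using power_separation[OF norm_z \<xi>0[OF that], of "n + 1"] by metis
  then obtain \<epsilon> where \<epsilon>: "\<And>\<xi>. \<xi>0 < \<xi> \<Longrightarrow> 0 < \<epsilon> \<xi>"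
      "\<And>\<xi> i j. \<xi>0 < \<xi> \<Longrightarrow> i < j \<Longrightarrow> j \<le> i + (n + 1) \<Longrightarrow> \<epsilon> \<xi> \<le> dist (z \<xi> ^ i) (z \<xi> ^ j)"
    by metis
  define U where "U \<xi> = {p \<in> topspace ?P. (fst p \<xi>, snd p \<xi>) \<in> {q. dist (fst q) (snd q) < \<epsilon> \<xi>}}" for \<xi>
  have "openin ?P (U \<xi>)" for \<xi>
    unfolding U_def by (intro openin_moore_product_coordinate open_Collect_less continuous_intros)
  \<comment> \<open>Only coordinates \<open>a \<mu>\<close> with \<mu> in \<open>T\<close> are used,
    so that \<open>osc_T\<close> applies; \<open>T\<close> is unbounded, which suffices for
    covering.\<close>
  moreover have "D \<subseteq> \<Union> ((\<lambda>\<mu>. U (a \<mu>)) ` {\<mu> \<in> T. \<xi>0 < \<mu>})"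
  proof
    fix p assume "p \<in> D"
    then obtain \<alpha> \<beta> where p: "p = (?w \<alpha>, ?w \<beta>)" using D_cases by blast
    obtain \<mu> where \<mu>: "\<mu> \<in> T" "max \<xi>0 (max \<alpha> \<beta>) < \<mu>"
      using uncountable_unbounded_omega1[OF unc_T[folded T_def]] .
    have "max \<xi>0 (max \<alpha> \<beta>) < a \<mu>" using \<mu>(2) ab(3) by (rule less_trans)
    then have "p \<in> U (a \<mu>)"
      using \<open>p \<in> D\<close> D \<epsilon>(1)[of "a \<mu>"] by (auto simp: U_def p w)
    with \<mu> show "p \<in> \<Union> ((\<lambda>\<mu>. U (a \<mu>)) ` {\<mu> \<in> T. \<xi>0 < \<mu>})" by auto
  qed
  ultimately obtain \<V> where \<V>: "countable \<V>" "\<V> \<subseteq> (\<lambda>\<mu>. U (a \<mu>)) ` {\<mu> \<in> T. \<xi>0 < \<mu>}" "D \<subseteq> \<Union>\<V>"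
    using Lindelof[unfolded Lindelof_space_subtopology_subset[OF D], rule_format,
        of "(\<lambda>\<mu>. U (a \<mu>)) ` {\<mu> \<in> T. \<xi>0 < \<mu>}"] by blast
  obtain M where M: "M \<subseteq> {\<mu> \<in> T. \<xi>0 < \<mu>}" "countable M" "\<V> = (\<lambda>\<mu>. U (a \<mu>)) ` M"
    using countable_subset_image[THEN iffD1, OF conjI[OF \<V>(1,2)]] by blast
  \<comment> \<open>Any \<nu> in \<open>T\<close> above \<gamma> gives a pair in \<open>D\<close>
    that no member of the subcover contains.\<close>
  obtain \<gamma> where \<gamma>: "\<And>\<mu>. \<mu> \<in> M \<Longrightarrow> a \<mu> < \<gamma>"
    using countable_bounded_omega1[OF countable_image[OF M(2), of a]] by auto
  obtain \<nu> where \<nu>: "\<nu> \<in> T" "\<gamma> < \<nu>"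
    using uncountable_unbounded_omega1[OF unc_T[folded T_def]] .
  obtain \<mu> where \<mu>: "\<mu> \<in> M" "(?w (a \<nu>), ?w (b \<nu>)) \<in> U (a \<mu>)"
    using subsetD[OF \<V>(3) ab(5)[of \<nu>]] unfolding M(3) by blast
  have "a \<mu> < \<nu>" using \<gamma>[OF \<mu>(1)] \<nu>(2) by (rule less_trans)
  have "\<mu> \<in> T" "\<xi>0 < \<mu>" using M(1) \<mu>(1) by auto
  have "\<xi>0 < a \<mu>" using \<open>\<xi>0 < \<mu>\<close> ab(3) by (rule less_trans)
  have "\<epsilon> (a \<mu>) \<le> dist (z (a \<mu>) ^ (osc C (a \<mu>) (a \<nu>) + 1)) (z (a \<mu>) ^ (osc C (a \<mu>) (b \<nu>) + 1))"
    using osc_T[OF \<open>\<mu> \<in> T\<close> \<nu>(1) \<open>a \<mu> < \<nu>\<close>] by (intro \<epsilon>(2)[OF \<open>\<xi>0 < a \<mu>\<close>]) linarith+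
  moreover have "a \<mu> < a \<nu>" "a \<mu> < b \<nu>"
    using less_trans[OF \<open>a \<mu> < \<nu>\<close>] ab(3,4) by blast+
  ultimately show False
    using \<mu>(2) by (simp add: U_def w)
qed

end
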